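(* There is no approximation algorithm for all-norm-TSP with multiplicative factor better than $1.78$, regardless of computational complexity assumptions (independently of whether $P = NP$). That is, there exists an instance $(V,s,d)$ such that for every feasible route $\sigma \in \mathcal{F}$, $$\sup_{\|\cdot\|} \frac{\|\ell^\sigma\|}{\min_{\sigma'\in\mathcal{F}} \|\ell^{\sigma'}\|} \ge 1.78,$$ where the supremum is over symmetric norms on $\mathbb{R}^V$.
   Context: An instance consists of a finite set $V$, a starting vertex $s \in V$, and a metric $d: V\times V \to \mathbb{R}_{\ge 0}$. $\mathcal{F}$ is the set of feasible routes, i.e. permutations $\sigma=(\sigma_1,\dots,\sigma_n)$ of $V$ with $\sigma_1 = s$; the visit time of $v=\sigma_i$ is $\ell^\sigma_v = \sum_{j=2}^{i} d(\sigma_{j-1},\sigma_j)$ (and $\ell^\sigma_s=0$). A symmetric norm is a norm on $\mathbb{R}^V$ invariant under coordinate permutations and sign changes. All-norm-TSP asks for a route $\sigma\in\mathcal{F}$ minimizing $\sup_{\|\cdot\|} \|\ell^\sigma\| / \min_{\sigma'\in\mathcal{F}}\|\ell^{\sigma'}\|$ over symmetric norms; an algorithm has factor $\alpha$ if its output always achieves value at most $\alpha$. *)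

theory Defs
  imports "HOL-Analysis.Analysis"
begin

text \<open>
  For a vertex set \<open>V\<close>, vectors of the space of real vectors indexed by \<open>V\<close> are represented by
  functions that vanish outside \<open>V\<close>.
\<close>

definition vecs :: "'a set \<Rightarrow> ('a \<Rightarrow> real) set" where
  "vecs V = {x. \<forall>v. v \<notin> V \<longrightarrow> x v = 0}"

text \<open>The values of \<open>N\<close> outside \<open>vecs V\<close> are unconstrained and never used.\<close>

definition norm_on :: "'a set \<Rightarrow> (('a \<Rightarrow> real) \<Rightarrow> real) \<Rightarrow> bool" where
  "norm_on V N \<longleftrightarrow>
     (\<forall>x\<in>vecs V. 0 \<le> N x) \<and>
     (\<forall>x\<in>vecs V. N x = 0 \<longleftrightarrow> x = (\<lambda>v. 0)) \<and>
     (\<forall>x\<in>vecs V. \<forall>c. N (\<lambda>v. c * x v) = \<bar>c\<bar> * N x) \<and>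
     (\<forall>x\<in>vecs V. \<forall>y\<in>vecs V. N (\<lambda>v. x v + y v) \<le> N x + N y)"

definition symmetric_norm :: "'a set \<Rightarrow> (('a \<Rightarrow> real) \<Rightarrow> real) \<Rightarrow> bool" where
  "symmetric_norm V N \<longleftrightarrow>
     norm_on V N \<and>
     (\<forall>x\<in>vecs V. \<forall>p. p permutes V \<longrightarrow> N (\<lambda>v. x (p v)) = N x) \<and>
     (\<forall>x\<in>vecs V. \<forall>e. (\<forall>v\<in>V. e v \<in> {-1, 1}) \<longrightarrow> N (\<lambda>v. e v * x v) = N x)"

definition tsp_instance :: "'a set \<Rightarrow> 'a \<Rightarrow> ('a \<Rightarrow> 'a \<Rightarrow> real) \<Rightarrow> bool" where
  "tsp_instance V s d \<longleftrightarrow> finite V \<and> s \<in> V \<and> Metric_space V d"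

definition routes :: "'a set \<Rightarrow> 'a \<Rightarrow> 'a list set" where
  "routes V s = {\<sigma>. distinct \<sigma> \<and> set \<sigma> = V \<and> \<sigma> \<noteq> [] \<and> \<sigma> ! 0 = s}"

definition position :: "'a list \<Rightarrow> 'a \<Rightarrow> nat" where
  "position \<sigma> v = (THE i. i < length \<sigma> \<and> \<sigma> ! i = v)"

text \<open>List indices start at \<open>0\<close>, so the sum ranges over the steps \<open>1\<close> up to the position of \<open>v\<close>.\<close>

definition visit_time :: "('a \<Rightarrow> 'a \<Rightarrow> real) \<Rightarrow> 'a list \<Rightarrow> 'a \<Rightarrow> real" where
  "visit_time d \<sigma> v =
     (if v \<in> set \<sigma> then \<Sum>j = 1..position \<sigma> v. d (\<sigma> ! (j - 1)) (\<sigma> ! j) else 0)"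

definition opt :: "'a set \<Rightarrow> 'a \<Rightarrow> ('a \<Rightarrow> 'a \<Rightarrow> real) \<Rightarrow> (('a \<Rightarrow> real) \<Rightarrow> real) \<Rightarrow> real" where
  "opt V s d N = Min ((\<lambda>\<sigma>. N (visit_time d \<sigma>)) ` routes V s)"

text \<open>
  The supremum is taken in the extended reals, so no boundedness side condition is involved.
  If \<open>V = {s}\<close>, all ratios are \<open>0 / 0 = 0\<close>; otherwise all denominators are positive.
\<close>

definition all_norm_value ::
    "'a set \<Rightarrow> 'a \<Rightarrow> ('a \<Rightarrow> 'a \<Rightarrow> real) \<Rightarrow> 'a list \<Rightarrow> ereal" where
  "all_norm_value V s d \<sigma> =
     (SUP N \<in> {N. symmetric_norm V N}. ereal (N (visit_time d \<sigma>) / opt V s d N))"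

text \<open>
  An algorithm is an arbitrary function from instances to feasible routes; no bound on its
  running time, and not even computability, is required.
\<close>

definition has_factor ::
    "('a set \<Rightarrow> 'a \<Rightarrow> ('a \<Rightarrow> 'a \<Rightarrow> real) \<Rightarrow> 'a list) \<Rightarrow> real \<Rightarrow> bool" where
  "has_factor alg \<alpha> \<longleftrightarrow>
     (\<forall>V s d. tsp_instance V s d \<longrightarrow>
        alg V s d \<in> routes V s \<and> all_norm_value V s d (alg V s d) \<le> ereal \<alpha>)"

lemma position_nth:
  assumes "distinct \<sigma>" and "i < length \<sigma>"
  shows "position \<sigma> (\<sigma> ! i) = i"
  unfolding position_def using assms by (auto simp: nth_eq_iff_index_eq)

lemma visit_time_nth:
  assumes "distinct \<sigma>" and "i < length \<sigma>"
  shows "visit_time d \<sigma> (\<sigma> ! i) = (\<Sum>j = 1..i. d (\<sigma> ! (j - 1)) (\<sigma> ! j))"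
  using assms by (simp add: visit_time_def position_nth)

lemma visit_time_in_vecs: "set \<sigma> = V \<Longrightarrow> visit_time d \<sigma> \<in> vecs V"
  by (auto simp: vecs_def visit_time_def)

lemma finite_routes: "finite V \<Longrightarrow> finite (routes V s)"
  by (rule finite_subset[OF _ finite_subset_distinct[of V]]) (auto simp: routes_def)

lemma routes_nonempty:
  assumes "finite V" and "s \<in> V"
  shows "routes V s \<noteq> {}"
proof -
  from assms obtain xs where "set xs = V - {s}" "distinct xs"
    using finite_distinct_list[of "V - {s}"] by auto
  with assms have "s # xs \<in> routes V s" by (auto simp: routes_def)
  then show ?thesis by auto
qed

end

theory Submission
  imports Defs
begin

text \<open>
  Place a large cluster \<open>A\<close> at \<open>10\<close>, a much smaller cluster \<open>B\<close> at \<open>-4\<close> and a single point \<open>c\<close> at \<open>15\<close> on a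
  line with the depot at \<open>0\<close>. Since the sizes decrease quickly, the norm summing the \<open>k\<close> largest entries,
  with \<open>k\<close> the size of \<open>A\<close>, of \<open>B\<close> or of \<open>c\<close>, essentially has per-entry optimum \<open>10\<close>, \<open>18\<close> or \<open>23\<close>,
  respectively. Consider the first visits to the clusters. If \<open>B\<close> is entered before \<open>A\<close>, then \<open>A\<close> is
  served at time at least \<open>18\<close>; if \<open>c\<close> precedes \<open>B\<close>, then \<open>B\<close> is served at time at least
  \<open>15 + 19 = 34\<close>; in the remaining order \<open>A, B, c\<close> the point \<open>c\<close> is served at time at least
  \<open>10 + 14 + 19 = 43\<close>. The ratios \<open>18/10\<close>, \<open>34/18\<close> and \<open>43/23\<close> all exceed \<open>1.78\<close>, with room for the
  small diameter of the clusters.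
\<close>

section \<open>Sums of the largest entries as symmetric norms\<close>

text \<open>The Ky Fan \<open>k\<close>-norm of a vector, between the maximum norm
  (\<open>k = 1\<close>) and the sum norm. Written as a maximum of seminorms over
  \<open>k\<close>-subsets, it gets the triangle inequality without sorting entries.\<close>

definition top_norm :: "'a set \<Rightarrow> nat \<Rightarrow> ('a \<Rightarrow> real) \<Rightarrow> real" where
  "top_norm V k x = Max ((\<lambda>A. \<Sum>v\<in>A. \<bar>x v\<bar>) ` {A. A \<subseteq> V \<and> card A = k})"

lemma top_norm_ge:
  assumes "finite V" "A \<subseteq> V" "card A = k"
  shows "(\<Sum>v\<in>A. \<bar>x v\<bar>) \<le> top_norm V k x"
  unfolding top_norm_def using assms by (intro Max_ge) auto

lemma top_norm_attained:
  assumes "finite V" "k \<le> card V"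
  obtains A where "A \<subseteq> V" "card A = k" "top_norm V k x = (\<Sum>v\<in>A. \<bar>x v\<bar>)"
proof -
  let ?S = "{A. A \<subseteq> V \<and> card A = k}"
  have "?S \<noteq> {}" using obtain_subset_with_card_n[OF assms(2)] by blast
  moreover have "finite ?S" using assms(1) by simp
  ultimately have "top_norm V k x \<in> (\<lambda>A. \<Sum>v\<in>A. \<bar>x v\<bar>) ` ?S"
    unfolding top_norm_def by (intro Max_in) auto
  then show thesis using that by auto
qed

text \<open>A permutation of \<open>V\<close> acts bijectively on the \<open>k\<close>-subsets, so
  both maxima range over the same sums. With \<open>p\<close> the identity this gives sign
  invariance, with \<open>y v = x (p v)\<close> permutation invariance.\<close>

lemma top_norm_cong_image:
  assumes p: "p permutes V" and eq: "\<And>v. \<bar>y v\<bar> = \<bar>x (p v)\<bar>"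
  shows "top_norm V k y = top_norm V k x"
proof -
  let ?S = "{A. A \<subseteq> V \<and> card A = k}"
  have inj: "inj_on p A" for A using permutes_inj_on[OF p] .
  have img: "(`) p ` ?S = ?S"
  proof
    show "(`) p ` ?S \<subseteq> ?S"
      using permutes_image[OF p] card_image[OF inj] by auto
    show "?S \<subseteq> (`) p ` ?S"
    proof
      fix A assume A: "A \<in> ?S"
      have q: "inv p permutes V" using permutes_inv[OF p] .
      have "A = p ` (inv p ` A)"
        using permutes_surj[OF p] by (simp add: image_f_inv_f)
      moreover have "inv p ` A \<in> ?S"
        using A permutes_image[OF q] card_image[OF permutes_inj_on[OF q]] by auto
      ultimately show "A \<in> (`) p ` ?S" by blast
    qed
  qed
  have "(\<Sum>v\<in>A. \<bar>y v\<bar>) = (\<Sum>v\<in>p ` A. \<bar>x v\<bar>)" for A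
    by (simp add: sum.reindex[OF inj] eq)
  then have "(\<lambda>A. \<Sum>v\<in>A. \<bar>y v\<bar>) ` ?S = (\<lambda>A. \<Sum>v\<in>A. \<bar>x v\<bar>) ` ((`) p ` ?S)"
    by (simp add: image_image)
  then show ?thesis by (simp add: top_norm_def img)
qed

lemma symmetric_norm_top_norm:
  assumes V: "finite V" and k: "0 < k" "k \<le> card V"
  shows "symmetric_norm V (top_norm V k)"
proof -
  have nonneg: "0 \<le> top_norm V k x" for x
    by (rule top_norm_attained[OF V k(2), of x]) (simp add: sum_nonneg)
  have zero: "x = (\<lambda>v. 0)" if x: "x \<in> vecs V" and "top_norm V k x = 0" for x
  proof
    fix v
    show "x v = 0"
    proof (cases "v \<in> V")
      case True
      \<comment> \<open>Since \<open>0 < k\<close>, the singleton of \<open>v\<close> extends to a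
        \<open>k\<close>-subset, whose sum bounds the entry at \<open>v\<close>.\<close>
      then obtain A where A: "v \<in> A" "A \<subseteq> V" "card A = k"
        using V k exists_subset_between[of "{v}" k V] by auto
      then have "finite A" using V finite_subset by blast
      then have "\<bar>x v\<bar> \<le> (\<Sum>v\<in>A. \<bar>x v\<bar>)" using A(1) by (intro member_le_sum) auto
      also have "\<dots> \<le> 0" using top_norm_ge[OF V A(2,3), of x] that by simp
      finally show ?thesis by simp
    qed (use x in \<open>simp add: vecs_def\<close>)
  qed
  have zero': "top_norm V k (\<lambda>v. 0) = 0"
    by (rule top_norm_attained[OF V k(2), of "\<lambda>v. 0"]) simp
  have scale_le: "top_norm V k (\<lambda>v. c * x v) \<le> \<bar>c\<bar> * top_norm V k x" for c x
    by (rule top_norm_attained[OF V k(2), of "\<lambda>v. c * x v"])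
      (simp add: abs_mult mult_left_mono top_norm_ge[OF V] flip: sum_distrib_left)
  have scale_ge: "\<bar>c\<bar> * top_norm V k x \<le> top_norm V k (\<lambda>v. c * x v)" for c x
  proof (rule top_norm_attained[OF V k(2), of x])
    fix A assume A: "A \<subseteq> V" "card A = k" "top_norm V k x = (\<Sum>v\<in>A. \<bar>x v\<bar>)"
    show ?thesis
      using top_norm_ge[OF V A(1,2), of "\<lambda>v. c * x v"] A(3) by (simp add: abs_mult sum_distrib_left)
  qed
  have triangle: "top_norm V k (\<lambda>v. x v + y v) \<le> top_norm V k x + top_norm V k y" for x y
  proof (rule top_norm_attained[OF V k(2), of "\<lambda>v. x v + y v"])
    fix A assume A: "A \<subseteq> V" "card A = k" "top_norm V k (\<lambda>v. x v + y v) = (\<Sum>v\<in>A. \<bar>x v + y v\<bar>)"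
    have "(\<Sum>v\<in>A. \<bar>x v + y v\<bar>) \<le> (\<Sum>v\<in>A. \<bar>x v\<bar>) + (\<Sum>v\<in>A. \<bar>y v\<bar>)"
      by (simp add: abs_triangle_ineq sum_mono flip: sum.distrib)
    then show ?thesis
      using A(3) top_norm_ge[OF V A(1,2), of x] top_norm_ge[OF V A(1,2), of y] by linarith
  qed
  have sign: "top_norm V k (\<lambda>v. e v * x v) = top_norm V k x"
    if "x \<in> vecs V" "\<forall>v\<in>V. e v \<in> {-1, 1}" for e x
    \<comment> \<open>The signs are constrained on \<open>V\<close> only, but \<open>x\<close>
      vanishes elsewhere, so absolute values agree everywhere.\<close>
    using that by (intro top_norm_cong_image[OF permutes_id]) (force simp: vecs_def abs_mult)
  have perm: "top_norm V k (\<lambda>v. x (p v)) = top_norm V k x" if "p permutes V" for p x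
    using that by (rule top_norm_cong_image) simp
  show ?thesis
    unfolding symmetric_norm_def norm_on_def
    using nonneg zero zero' antisym[OF scale_le scale_ge] triangle sign perm by blast
qed

lemma top_norm_ge_const:
  assumes "finite V" "A \<subseteq> V" "card A = k" "\<And>v. v \<in> A \<Longrightarrow> t \<le> x v"
  shows "real k * t \<le> top_norm V k x"
proof -
  have "real k * t = (\<Sum>v\<in>A. t)" using assms(3) by simp
  also have "\<dots> \<le> (\<Sum>v\<in>A. \<bar>x v\<bar>)" using assms(4) by (intro sum_mono) force
  also have "\<dots> \<le> top_norm V k x" using assms(1-3) by (rule top_norm_ge)
  finally show ?thesis .
qed

text \<open>Whichever \<open>k\<close> entries are chosen, the excess \<open>t'\<close> is paid at
  most \<open>card E\<close> times. For \<open>k\<close> much larger than \<open>card E\<close> a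
  late visit to \<open>E\<close> is thus almost free.\<close>

lemma top_norm_le_exceptional:
  assumes V: "finite V" and k: "k \<le> card V" and E: "E \<subseteq> V" and t: "0 \<le> t'"
    and x: "\<And>v. v \<in> V - E \<Longrightarrow> \<bar>x v\<bar> \<le> t" "\<And>v. v \<in> E \<Longrightarrow> \<bar>x v\<bar> \<le> t + t'"
  shows "top_norm V k x \<le> real k * t + real (card E) * t'"
proof (rule top_norm_attained[OF V k, of x])
  fix A assume A: "A \<subseteq> V" "card A = k" "top_norm V k x = (\<Sum>v\<in>A. \<bar>x v\<bar>)"
  have fin: "finite A" "finite E" using A(1) E V finite_subset by blast+
  have "(\<Sum>v\<in>A. \<bar>x v\<bar>) \<le> (\<Sum>v\<in>A. t + (if v \<in> E then t' else 0))"
    using x A(1) by (intro sum_mono) auto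
  also have "\<dots> = real k * t + real (card (A \<inter> E)) * t'"
    using fin A(2) by (simp add: sum.distrib sum.If_cases)
  also have "\<dots> \<le> real k * t + real (card E) * t'"
    using fin t by (simp add: card_mono mult_right_mono)
  finally show ?thesis using A(3) by simp
qed

section \<open>Visit times\<close>

text \<open>The triangle inequality, applied to each step from \<open>i\<close> to
  \<open>j\<close>.\<close>

lemma visit_time_later:
  assumes d: "Metric_space V d" and \<sigma>: "distinct \<sigma>" "set \<sigma> \<subseteq> V" and "i \<le> j" "j < length \<sigma>"
  shows "visit_time d \<sigma> (\<sigma> ! i) + d (\<sigma> ! i) (\<sigma> ! j) \<le> visit_time d \<sigma> (\<sigma> ! j)"
  using \<open>i \<le> j\<close> \<open>j < length \<sigma>\<close>
proof (induction j rule: dec_induct)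
  case base
  then have "\<sigma> ! i \<in> V" using \<sigma>(2) nth_mem by blast
  then show ?case using Metric_space.mdist_zero[OF d] by simp
next
  case (step j)
  have "\<sigma> ! i \<in> V" "\<sigma> ! j \<in> V" "\<sigma> ! Suc j \<in> V" using step \<sigma>(2) by (auto intro!: subsetD[OF \<sigma>(2)])
  then have "d (\<sigma> ! i) (\<sigma> ! Suc j) \<le> d (\<sigma> ! i) (\<sigma> ! j) + d (\<sigma> ! j) (\<sigma> ! Suc j)"
    by (rule Metric_space.triangle[OF d])
  then show ?case using step \<sigma>(1) by (simp add: visit_time_nth)
qed

lemma visit_time_linear:
  assumes d: "Metric_space V d" and \<sigma>: "distinct \<sigma>" "set \<sigma> \<subseteq> V" and "u \<in> set \<sigma>" "v \<in> set \<sigma>"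
  shows "visit_time d \<sigma> u + d u v \<le> visit_time d \<sigma> v \<or> visit_time d \<sigma> v + d v u \<le> visit_time d \<sigma> u"
proof -
  obtain i j where "i < length \<sigma>" "j < length \<sigma>" "u = \<sigma> ! i" "v = \<sigma> ! j"
    using assms(4,5) by (metis in_set_conv_nth)
  then show ?thesis using visit_time_later[OF d \<sigma>, of i j] visit_time_later[OF d \<sigma>, of j i]
    by (cases "i \<le> j") auto
qed

lemma visit_time_hd: "distinct (s # \<sigma>) \<Longrightarrow> visit_time d (s # \<sigma>) s = 0"
  using visit_time_nth[of "s # \<sigma>" 0 d] by simp

lemma visit_time_start:
  assumes d: "Metric_space V d" and \<sigma>: "\<sigma> \<in> routes V s" and v: "v \<in> V"
  shows "d s v \<le> visit_time d \<sigma> v"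
proof -
  have *: "distinct \<sigma>" "set \<sigma> = V" "\<sigma> \<noteq> []" "\<sigma> ! 0 = s" using \<sigma> by (auto simp: routes_def)
  then obtain j where "j < length \<sigma>" "v = \<sigma> ! j" using v by (metis in_set_conv_nth)
  moreover have "visit_time d \<sigma> (\<sigma> ! 0) = 0" using * by (subst visit_time_nth) auto
  ultimately show ?thesis using visit_time_later[OF d *(1), of 0 j] * by simp
qed

lemma visit_time_append:
  assumes "distinct (\<sigma> @ \<tau>)" "v \<in> set \<sigma>"
  shows "visit_time d (\<sigma> @ \<tau>) v = visit_time d \<sigma> v"
proof -
  obtain i where i: "i < length \<sigma>" "v = \<sigma> ! i" using assms(2) by (metis in_set_conv_nth)
  have "visit_time d (\<sigma> @ \<tau>) ((\<sigma> @ \<tau>) ! i) = visit_time d \<sigma> (\<sigma> ! i)"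
    using assms(1) i by (subst (1 2) visit_time_nth) (auto simp: nth_append intro!: sum.cong)
  then show ?thesis using i by (simp add: nth_append)
qed

lemma visit_time_snoc:
  assumes "distinct (\<sigma> @ [v])" "\<sigma> \<noteq> []"
  shows "visit_time d (\<sigma> @ [v]) v = visit_time d \<sigma> (last \<sigma>) + d (last \<sigma>) v"
proof -
  obtain m where m: "length \<sigma> = Suc m" using assms(2) by (cases \<sigma>) auto
  have l: "last \<sigma> = \<sigma> ! m" using m assms(2) by (simp add: last_conv_nth)
  have "visit_time d (\<sigma> @ [v]) ((\<sigma> @ [v]) ! Suc m)
      = (\<Sum>j = 1..m. d (\<sigma> ! (j - 1)) (\<sigma> ! j)) + d (\<sigma> ! m) v"
    using assms(1) m by (subst visit_time_nth) (auto simp: nth_append intro!: sum.cong)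
  moreover have "visit_time d \<sigma> (\<sigma> ! m) = (\<Sum>j = 1..m. d (\<sigma> ! (j - 1)) (\<sigma> ! j))"
    using assms(1) m by (intro visit_time_nth) auto
  ultimately show ?thesis using m l by (simp add: nth_append)
qed

text \<open>\<open>P\<close> orders points along a geodesic, on which distances add up, so the steps
  after \<open>last \<sigma>\<close> telescope. The induction appends at the end because visit times
  depend only on the prefix of the route.\<close>

lemma visit_time_geodesic:
  assumes "distinct (\<sigma> @ \<tau>)" "\<sigma> \<noteq> []" "sorted_wrt P (last \<sigma> # \<tau>)"
    and add: "\<And>u v w. P u v \<Longrightarrow> P v w \<Longrightarrow> d u w = d u v + d v w"
    and "v \<in> set \<tau>"
  shows "visit_time d (\<sigma> @ \<tau>) v = visit_time d \<sigma> (last \<sigma>) + d (last \<sigma>) v"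
  using assms(1,3,5)
proof (induction \<tau> arbitrary: v rule: rev_induct)
  case (snoc w \<tau>)
  have sub: "distinct (\<sigma> @ \<tau>)" "sorted_wrt P (last \<sigma> # \<tau>)"
    using snoc.prems by (auto simp: sorted_wrt_append)
  show ?case
  proof (cases "v = w")
    case False
    then have v: "v \<in> set \<tau>" using snoc.prems by auto
    then have "visit_time d ((\<sigma> @ \<tau>) @ [w]) v = visit_time d (\<sigma> @ \<tau>) v"
      using snoc.prems by (intro visit_time_append) auto
    then show ?thesis using snoc.IH[OF sub v] by simp
  next
    case True
    have eq: "visit_time d (\<sigma> @ \<tau> @ [w]) w
        = visit_time d (\<sigma> @ \<tau>) (last (\<sigma> @ \<tau>)) + d (last (\<sigma> @ \<tau>)) w"
      using visit_time_snoc[of "\<sigma> @ \<tau>" w d] snoc.prems \<open>\<sigma> \<noteq> []\<close> by simp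
    show ?thesis
    proof (cases "\<tau> = []")
      case False
      then have l: "last \<tau> \<in> set \<tau>" by simp
      then have "P (last \<sigma>) (last \<tau>)" "P (last \<tau>) w"
        using snoc.prems by (auto simp: sorted_wrt_append)
      then show ?thesis using eq snoc.IH[OF sub l] add False True by simp
    qed (use eq True in simp)
  qed
qed simp

text \<open>The route runs outward through \<open>X\<close>, turns at \<open>last X\<close>, and
  returns past \<open>s\<close> through \<open>Y\<close> on the other side. Each sweep is
  geodesic.\<close>

lemma visit_time_two_sweeps:
  assumes "distinct (s # X @ Y)" "sorted_wrt P (s # X)" "sorted_wrt (\<lambda>u v. P v u) (s # Y)"
    and "transp P" and add: "\<And>u v w. P u v \<Longrightarrow> P v w \<Longrightarrow> d u w = d u v + d v w"
    and sym: "\<And>u v. d u v = d v u" and "X \<noteq> []"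
  shows "v \<in> set X \<Longrightarrow> visit_time d (s # X @ Y) v = d s v"
    and "v \<in> set Y \<Longrightarrow> visit_time d (s # X @ Y) v = d s (last X) + d (last X) v"
proof -
  have X: "visit_time d (s # X) v = d s v" if "v \<in> set X" for v
    using visit_time_geodesic[of "[s]" X P d v] assms(1,2) add that
    by (simp add: visit_time_hd)
  show "visit_time d (s # X @ Y) v = d s v" if "v \<in> set X"
    using visit_time_append[of "s # X" Y v d] assms(1) X that by simp
  \<comment> \<open>Transitivity through \<open>s\<close> makes the turning point and
    \<open>Y\<close> one monotone sweep.\<close>
  have "P v (last X)" if "v \<in> set Y" for v
  proof -
    have "P v s" "P s (last X)" using assms(2,3) that \<open>X \<noteq> []\<close> by auto
    then show ?thesis using transpD[OF \<open>transp P\<close>] by metis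
  qed
  then have "sorted_wrt (\<lambda>u v. P v u) (last X # Y)" using assms(3) by simp
  moreover have "d u w = d u v + d v w" if "P v u" "P w v" for u v w
    using add[OF that(2,1)] sym by (metis add.commute)
  ultimately have "visit_time d (s # X @ Y) v = visit_time d (s # X) (last X) + d (last X) v"
    if "v \<in> set Y"
    using visit_time_geodesic[of "s # X" Y "\<lambda>u v. P v u" d v] assms(1) that \<open>X \<noteq> []\<close> by simp
  then show "visit_time d (s # X @ Y) v = d s (last X) + d (last X) v" if "v \<in> set Y"
    using that X[of "last X"] \<open>X \<noteq> []\<close> by simp
qed

text \<open>One norm bounds the supremum from below, and one competitor \<open>\<rho>\<close> bounds
  the optimum from above. The vertex \<open>v\<close> other than \<open>s\<close> makes the optimum
  positive, so the quotient is not the default value of division by zero.\<close>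

lemma all_norm_value_ge:
  assumes inst: "tsp_instance V s d" and N: "symmetric_norm V N" and "v \<in> V" "v \<noteq> s"
    and \<rho>: "\<rho> \<in> routes V s" and "0 \<le> \<alpha>" and le: "\<alpha> * N (visit_time d \<rho>) \<le> N (visit_time d \<sigma>)"
  shows "ereal \<alpha> \<le> all_norm_value V s d \<sigma>"
proof -
  have V: "finite V" "s \<in> V" and d: "Metric_space V d" using inst by (auto simp: tsp_instance_def)
  have pos: "0 < N (visit_time d \<tau>)" if \<tau>: "\<tau> \<in> routes V s" for \<tau>
  proof -
    have "0 < d s v" using Metric_space.mdist_pos_less[OF d] assms(3,4) V by metis
    then have "visit_time d \<tau> v \<noteq> 0" using visit_time_start[OF d \<tau> \<open>v \<in> V\<close>] by simp
    then have "visit_time d \<tau> \<noteq> (\<lambda>v. 0)" by metis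
    moreover have "visit_time d \<tau> \<in> vecs V" using \<tau> by (auto simp: routes_def intro: visit_time_in_vecs)
    ultimately show ?thesis using N by (force simp: symmetric_norm_def norm_on_def less_le)
  qed
  let ?T = "(\<lambda>\<sigma>. N (visit_time d \<sigma>)) ` routes V s"
  have fin: "finite ?T" "?T \<noteq> {}" using finite_routes[OF V(1)] \<rho> by auto
  have "0 < opt V s d N" using Min_in[OF fin] pos by (auto simp: opt_def)
  moreover have "opt V s d N \<le> N (visit_time d \<rho>)" using fin(1) \<rho> by (auto simp: opt_def)
  ultimately have "\<alpha> \<le> N (visit_time d \<sigma>) / opt V s d N"
    using le mult_left_mono[OF _ \<open>0 \<le> \<alpha>\<close>, of "opt V s d N" "N (visit_time d \<rho>)"]
    by (simp add: le_divide_eq)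
  also have "ereal (N (visit_time d \<sigma>) / opt V s d N) \<le> all_norm_value V s d \<sigma>"
    unfolding all_norm_value_def using N by (intro SUP_upper) simp
  finally show ?thesis by simp
qed

section \<open>The instance\<close>

text \<open>
  Vertices are their own positions on the line. The unit of length is \<open>10\<^sup>7\<close>, and \<open>west\<close>, \<open>east\<close> and
  \<open>far\<close> play the roles of \<open>B\<close>, \<open>A\<close> and \<open>c\<close>.
\<close>

definition west :: "nat set" where "west = {..<10}"

text \<open>The offset 10 absorbs the width of \<open>west\<close>: all of \<open>west\<close> lies
  more than 4 units away, and all of \<open>east\<close> more than 10, so the lower bounds 18, 34
  and 43 hold without error terms.\<close>

definition depot :: nat where "depot = 40000010"

definition east :: "nat set" where "east = {140000011..140010010}"

definition far :: nat where "far = 190000010"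

definition points :: "nat set" where "points = insert depot (insert far (west \<union> east))"

definition line_dist :: "nat \<Rightarrow> nat \<Rightarrow> real" where "line_dist u v = \<bar>real u - real v\<bar>"

lemma Metric_space_line_dist: "Metric_space V line_dist"
  by unfold_locales (auto simp: line_dist_def)

lemma finite_groups: "finite west" "finite east" "finite points"
  by (auto simp: west_def east_def points_def)

lemma card_groups: "card west = 10" "card east = 10000"
  by (auto simp: west_def east_def)

lemma west_bounds: "v \<in> west \<Longrightarrow> v < 10"
  by (simp add: west_def)

lemma east_bounds: "v \<in> east \<Longrightarrow> 140000010 < v \<and> v \<le> 140010010"
  by (simp add: east_def)

lemma groups_subset: "east \<subseteq> points" "west \<subseteq> points" "far \<in> points"
  by (auto simp: points_def)

lemma groups_disjoint:
  "depot \<notin> east" "depot \<notin> west" "far \<notin> east" "far \<notin> west" "depot \<noteq> far" "east \<inter> west = {}"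
  using west_bounds east_bounds by (auto simp: west_def east_def depot_def far_def)

lemma card_points_ge: "10000 \<le> card points"
  using card_mono[OF finite_groups(3) groups_subset(1)] card_groups by simp

lemma tsp_instance_points: "tsp_instance points depot line_dist"
  using finite_groups Metric_space_line_dist by (simp add: tsp_instance_def points_def)

section \<open>The two comparison routes and their visit times\<close>

definition east_list :: "nat list" where "east_list = sorted_list_of_set east @ [far]"

definition west_list :: "nat list" where "west_list = rev (sorted_list_of_set west)"

lemma set_lists: "set east_list = insert far east" "set west_list = west"
  using finite_groups by (auto simp: east_list_def west_list_def)

lemma lists_nonempty: "east_list \<noteq> []" "west_list \<noteq> []"
  using finite_groups card_groups by (auto simp: east_list_def west_list_def)

lemma last_lists: "last east_list = far" "last west_list < 10"
  using last_in_set[OF lists_nonempty(2)] west_bounds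
  by (simp_all add: east_list_def set_lists)

lemma sorted_lists:
  "sorted_wrt (<) (depot # east_list)" "sorted_wrt (\<lambda>u v. v < u) (depot # west_list)"
proof -
  have "v < far \<and> depot < v" if "v \<in> east" for v
    using east_bounds[OF that] by (simp add: depot_def far_def)
  moreover have "v < depot" if "v \<in> west" for v
    using west_bounds[OF that] by (simp add: depot_def)
  moreover have "depot < far" by (simp add: depot_def far_def)
  ultimately show "sorted_wrt (<) (depot # east_list)" "sorted_wrt (\<lambda>u v. v < u) (depot # west_list)"
    using finite_groups by (simp_all add: east_list_def west_list_def sorted_wrt_append sorted_wrt_rev)
qed

lemma distinct_lists:
  "distinct (depot # east_list @ west_list)" "distinct (depot # west_list @ east_list)"
  using groups_disjoint finite_groups by (auto simp: east_list_def west_list_def)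

lemma two_sweep_routes:
  "depot # east_list @ west_list \<in> routes points depot"
  "depot # west_list @ east_list \<in> routes points depot"
  using distinct_lists by (auto simp: routes_def set_lists points_def)

lemma line_dist_add:
  "u < v \<Longrightarrow> v < w \<Longrightarrow> line_dist u w = line_dist u v + line_dist v w"
  "v < u \<Longrightarrow> w < v \<Longrightarrow> line_dist u w = line_dist u v + line_dist v w"
  by (simp_all add: line_dist_def)

lemma line_dist_commute: "line_dist u v = line_dist v u"
  by (simp add: line_dist_def)

lemma visit_time_east_first:
  fixes v
  defines "t \<equiv> visit_time line_dist (depot # east_list @ west_list)"
  shows "v \<in> points \<Longrightarrow> \<bar>t v\<bar> \<le> 340000010"
    and "v \<in> points - insert far west \<Longrightarrow> \<bar>t v\<bar> \<le> 100010000"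
proof -
  note sweeps = visit_time_two_sweeps[of depot east_list west_list "(<)" line_dist v,
      OF distinct_lists(1) sorted_lists transp_on_less _ line_dist_commute lists_nonempty(1),
      unfolded set_lists last_lists, folded t_def]
  have east: "t v = line_dist depot v" if "v \<in> insert far east"
    using that by (intro sweeps(1) line_dist_add)
  have west: "t v = line_dist depot far + line_dist far v" if "v \<in> west"
    using that by (intro sweeps(2) line_dist_add)
  have start: "t depot = 0" unfolding t_def using visit_time_hd[OF distinct_lists(1)] .
  show "\<bar>t v\<bar> \<le> 340000010" if "v \<in> points"
    using that start east west west_bounds[of v] east_bounds[of v]
    by (auto simp: points_def line_dist_def depot_def far_def)
  show "\<bar>t v\<bar> \<le> 100010000" if "v \<in> points - insert far west"
    using that start east east_bounds[of v] by (auto simp: points_def line_dist_def depot_def)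
qed

lemma visit_time_west_first:
  fixes v
  defines "t \<equiv> visit_time line_dist (depot # west_list @ east_list)"
  shows "v \<in> points \<Longrightarrow> \<bar>t v\<bar> \<le> 230000020"
    and "v \<in> points - {far} \<Longrightarrow> \<bar>t v\<bar> \<le> 180010020"
proof -
  note sweeps = visit_time_two_sweeps[of depot west_list east_list "(>)" line_dist v,
      OF distinct_lists(2) sorted_lists(2,1) transp_on_greater _ line_dist_commute lists_nonempty(2),
      unfolded set_lists, folded t_def]
  have west: "t v = line_dist depot v" if "v \<in> west"
    using that by (intro sweeps(1) line_dist_add)
  have east: "t v = line_dist depot (last west_list) + line_dist (last west_list) v"
    if "v \<in> insert far east"
    using that by (intro sweeps(2) line_dist_add)
  have start: "t depot = 0" unfolding t_def using visit_time_hd[OF distinct_lists(2)] .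
  note bounds = last_lists(2) west_bounds[of v] east_bounds[of v]
  \<comment> \<open>The worst turning point is 0: then \<open>far\<close> is reached at 40000010 +
    190000010, and the end of \<open>east\<close> at 40000010 + 140010010 = 180010020.\<close>
  show "\<bar>t v\<bar> \<le> 230000020" if "v \<in> points"
    using that start east west bounds by (auto simp: points_def line_dist_def depot_def far_def)
  show "\<bar>t v\<bar> \<le> 180010020" if "v \<in> points - {far}"
    using that start east west bounds by (auto simp: points_def line_dist_def depot_def)
qed

section \<open>Upper bounds on the optima\<close>

lemma top_norm_east_first:
  "top_norm points 10000 (visit_time line_dist (depot # east_list @ west_list))
    \<le> real 10000 * 100010000 + real (card (insert far west)) * 240000000"
proof (rule top_norm_le_exceptional[OF finite_groups(3) card_points_ge])
  show "insert far west \<subseteq> points" using groups_subset by simp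
  \<comment> \<open>The excess 240000000 is rounded up: the latest visit, at the end of the return
    sweep, is at most 150000000 + 190000010.\<close>
  then show "\<bar>visit_time line_dist (depot # east_list @ west_list) v\<bar> \<le> 100010000 + 240000000"
    if "v \<in> insert far west" for v
    using visit_time_east_first(1)[of v] that by auto
qed (simp_all add: visit_time_east_first(2))

text \<open>This one route serves both small norms, \<open>k = 10\<close> and \<open>k = 1\<close>;
  only \<open>far\<close> exceeds 180010020, by at most 49990000.\<close>

lemma top_norm_west_first:
  assumes "k \<le> 10000"
  shows "top_norm points k (visit_time line_dist (depot # west_list @ east_list))
    \<le> real k * 180010020 + real (card {far}) * 49990000"
proof (rule top_norm_le_exceptional[OF finite_groups(3)])
  show "k \<le> card points" using assms card_points_ge by simp
  show "{far} \<subseteq> points" using groups_subset by simp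
  then show "\<bar>visit_time line_dist (depot # west_list @ east_list) v\<bar> \<le> 180010020 + 49990000"
    if "v \<in> {far}" for v
    using visit_time_west_first(1)[of v] that by auto
qed (simp_all add: visit_time_west_first(2))

section \<open>The lower bound for every route\<close>

lemma all_norm_value_points_ge:
  assumes \<sigma>: "\<sigma> \<in> routes points depot" and k: "0 < k" "k \<le> 10000"
    and A: "A \<subseteq> points" "card A = k" "\<And>v. v \<in> A \<Longrightarrow> t \<le> visit_time line_dist \<sigma> v"
    and \<rho>: "\<rho> \<in> routes points depot"
    and le: "1.78 * top_norm points k (visit_time line_dist \<rho>) \<le> real k * t"
  shows "ereal 1.78 \<le> all_norm_value points depot line_dist \<sigma>"
proof (rule all_norm_value_ge[OF tsp_instance_points _ _ _ \<rho>])
  show "symmetric_norm points (top_norm points k)"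
    using k card_points_ge finite_groups by (intro symmetric_norm_top_norm) auto
  show "far \<in> points" "far \<noteq> depot" using groups_subset by (auto simp: far_def depot_def)
  have "real k * t \<le> top_norm points k (visit_time line_dist \<sigma>)"
    using finite_groups(3) A by (rule top_norm_ge_const)
  then show "1.78 * top_norm points k (visit_time line_dist \<rho>)
      \<le> top_norm points k (visit_time line_dist \<sigma>)" using le by linarith
qed simp

lemma all_norm_value_points:
  assumes \<sigma>: "\<sigma> \<in> routes points depot"
  shows "ereal 1.78 \<le> all_norm_value points depot line_dist \<sigma>"
proof -
  define t where "t = visit_time line_dist \<sigma>"
  have set: "distinct \<sigma>" "set \<sigma> = points" using \<sigma> by (auto simp: routes_def)
  have lin: "t u + line_dist u v \<le> t v \<or> t v + line_dist v u \<le> t u" if "u \<in> points" "v \<in> points" for u v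
    unfolding t_def using visit_time_linear[OF Metric_space_line_dist, of \<sigma> points u v] set that by simp
  have start: "line_dist depot v \<le> t v" if "v \<in> points" for v
    unfolding t_def using visit_time_start[OF Metric_space_line_dist \<sigma> that] .
  have ne: "west \<noteq> {}" "east \<noteq> {}" using card_groups by auto
  \<comment> \<open>A bound for the first visited point of a cluster holds for the whole cluster, so
    only the order of \<open>a\<close>, \<open>b\<close> and \<open>far\<close> matters.\<close>
  obtain a where a: "a \<in> east" "\<And>v. v \<in> east \<Longrightarrow> t a \<le> t v"
    using ex_min_if_finite[of "t ` east"] ne finite_groups by (force simp: not_less)
  obtain b where b: "b \<in> west" "\<And>v. v \<in> west \<Longrightarrow> t b \<le> t v"
    using ex_min_if_finite[of "t ` west"] ne finite_groups by (force simp: not_less)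
  have pts: "a \<in> points" "b \<in> points" using a b groups_subset by auto
  note bounds = east_bounds[OF a(1)] west_bounds[OF b(1)]
  note ge = all_norm_value_points_ge[OF \<sigma>, folded t_def]
  \<comment> \<open>If neither \<open>b\<close> precedes \<open>a\<close> nor \<open>far\<close>
    precedes \<open>b\<close>, the order is \<open>a\<close>, \<open>b\<close>,
    \<open>far\<close>.\<close>
  consider "t b + line_dist b a \<le> t a" | "t far + line_dist far b \<le> t b"
    | "t a + line_dist a b \<le> t b" "t b + line_dist b far \<le> t far"
    using lin[OF pts] lin[OF pts(2) groups_subset(3)] by blast
  then show ?thesis
  proof cases
    case 1
    have "180000000 \<le> t v" if "v \<in> east" for v
      using 1 a(2)[OF that] start[OF pts(2)] bounds by (simp add: line_dist_def depot_def)
    moreover have "card (insert far west) = 11"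
      using groups_disjoint(4) finite_groups card_groups by simp
    \<comment> \<open>The tightest case: in units, 10000 * 18 against 10000 * 10.001 + 11 * 24, a
      ratio of about 1.795.\<close>
    ultimately show ?thesis
      using top_norm_east_first
      by (intro ge[OF _ _ groups_subset(1) card_groups(2) _ two_sweep_routes(1), of 180000000]) auto
  next
    case 2
    have "340000000 \<le> t v" if "v \<in> west" for v
      using 2 b(2)[OF that] start[OF groups_subset(3)] bounds
      by (simp add: line_dist_def depot_def far_def)
    then show ?thesis
      using top_norm_west_first[of 10]
      by (intro ge[OF _ _ groups_subset(2) card_groups(1) _ two_sweep_routes(2), of 340000000]) auto
  next
    case 3
    have "430000000 \<le> t far"
      using 3 start[OF pts(1)] bounds by (simp add: line_dist_def depot_def far_def)
    \<comment> \<open>For \<open>k = 1\<close> the norm is the maximum norm, so the single point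
      \<open>far\<close> suffices.\<close>
    then show ?thesis
      using top_norm_west_first[of 1] groups_subset(3)
      by (intro ge[OF _ _ _ _ _ two_sweep_routes(2), of 1 "{far}" 430000000]) auto
  qed
qed

theorem theorem3:
  shows "(\<exists>(V :: nat set) s d. tsp_instance V s d \<and>
            (\<forall>\<sigma>\<in>routes V s. all_norm_value V s d \<sigma> \<ge> ereal 1.78)) \<and>
         (\<nexists>(alg :: nat set \<Rightarrow> nat \<Rightarrow> (nat \<Rightarrow> nat \<Rightarrow> real) \<Rightarrow> nat list) \<alpha>.
            has_factor alg \<alpha> \<and> \<alpha> < 1.78)"
proof
  show "\<exists>(V :: nat set) s d. tsp_instance V s d \<and>
      (\<forall>\<sigma>\<in>routes V s. all_norm_value V s d \<sigma> \<ge> ereal 1.78)"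
    using tsp_instance_points all_norm_value_points by blast
  have "1.78 \<le> \<alpha>" if "has_factor alg \<alpha>" for alg :: "nat set \<Rightarrow> nat \<Rightarrow> (nat \<Rightarrow> nat \<Rightarrow> real) \<Rightarrow> nat list" and \<alpha>
  proof -
    have "alg points depot line_dist \<in> routes points depot"
      "all_norm_value points depot line_dist (alg points depot line_dist) \<le> ereal \<alpha>"
      using that tsp_instance_points by (auto simp: has_factor_def)
    then have "ereal 1.78 \<le> ereal \<alpha>" using all_norm_value_points order_trans by blast
    then show ?thesis by simp
  qed
  then show "\<nexists>(alg :: nat set \<Rightarrow> nat \<Rightarrow> (nat \<Rightarrow> nat \<Rightarrow> real) \<Rightarrow> nat list) \<alpha>.
      has_factor alg \<alpha> \<and> \<alpha> < 1.78"
    by (meson not_less)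
qed

end
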